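(* Let $\mathcal F=\{\langle\cdot,\cdot\rangle_i\}_{i\in I}$ be a family of inner products on a vector space $V$ over a field $\mathbb{K}$, let $\mathfrak U$ be an ultrafilter on the directed set $I$ containing all the sets $[i,\to)$, $i\in I$, let $\mathbb{F}=\prod_{i\in I}\mathbb{K}/\mathfrak U$, and let $\langle\!\langle\cdot,\cdot\rangle\!\rangle_{\mathbb{F}}$ be the induced inner product on $V_{\mathbb{F}}=V\otimes_{\mathbb K}\mathbb{F}$. Then: (i) If $\mathcal F$ is nonpathological and simultaneously orthogonalizable, then $\langle\!\langle\cdot,\cdot\rangle\!\rangle_{\mathbb{F}}$ is nondegenerate. (ii) If $\langle\!\langle\cdot,\cdot\rangle\!\rangle_{\mathbb{F}}$ is nondegenerate, then $\mathcal F$ is nonpathological.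
   Context: An inner product on a vector space is a symmetric bilinear form with values in the ground field; it is nondegenerate if its radical $\{x\colon\langle x,V\rangle=0\}$ is $0$. A family $\{\langle\cdot,\cdot\rangle_i\}_{i\in I}$ of inner products on $V$ is simultaneously orthogonalizable if there is a basis $\{v_j\}$ of $V$ with $\langle v_j,v_k\rangle_i=0$ for all $i\in I$ and all $j\ne k$. The index set $I$ is assumed to be a directed set for some preorder $\le$ (no loss of generality, e.g. by well-ordering $I$): for all $i,j\in I$ there is $k\in I$ with $i,j\le k$. For $i\in I$, $[i,\to):=\{j\in I\colon i\le j\}$. $\mathfrak U$ is a fixed ultrafilter on $I$ containing the filter $\{S\subset I\colon\exists i\in I,\ [i,\to)\subset S\}$. $\mathbb{F}=\prod_{i\in I}\mathbb{K}_i/\mathfrak U$ with $\mathbb{K}_i=\mathbb{K}$ is the ultrapower: $(x_i)\equiv(y_i)$ iff $\{i\colon x_i=y_i\}\in\mathfrak U$, with class $[(x_i)]$ and componentwise operations; it is an extension field of $\mathbb{K}$ through constant families. An element $x\in V$ is pathological if for every finite-dimensional subspace $S$ of $V$ the set $\{i\in I\colon\langle x,S\rangle_i=0\}$ belongs to $\mathfrak U$. The set of pathological elements is denoted $\mathrm{path}_{\mathcal F}(V)$, and $\mathcal F$ is nonpathological if $\mathrm{path}_{\mathcal F}(V)=0$. $\langle\!\langle\cdot,\cdot\rangle\!\rangle\colon V\times V\to\mathbb{F}$ is the $\mathbb{K}$-bilinear symmetric map $\langle\!\langle x,y\rangle\!\rangle:=[(\langle x,y\rangle_i)_{i\in I}]$,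 and $\langle\!\langle\cdot,\cdot\rangle\!\rangle_{\mathbb{F}}\colon V_{\mathbb{F}}\times V_{\mathbb{F}}\to\mathbb{F}$ is the inner product on $V_{\mathbb F}$ with $\langle\!\langle x\otimes\lambda,y\otimes\mu\rangle\!\rangle_{\mathbb{F}}:=\lambda\mu\langle\!\langle x,y\rangle\!\rangle$. *)

theory Defs
  imports Complex_Main "HOL-Algebra.Free_Abelian_Groups" "HOL-Algebra.Module"
begin

section \<open>Families of inner products on a vector space\<close>

text \<open>\<open>(*)\<close> is the field \<open>'k\<close> regarded as a vector space over itself.\<close>

definition inner_product ::
  "('k::field \<Rightarrow> 'v::ab_group_add \<Rightarrow> 'v) \<Rightarrow> ('v \<Rightarrow> 'v \<Rightarrow> 'k) \<Rightarrow> bool" where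
  "inner_product scale B \<longleftrightarrow>
     (\<forall>x y. B x y = B y x) \<and> (\<forall>x. Vector_Spaces.linear scale (*) (B x))"

definition simultaneously_orthogonalizable ::
  "('k::field \<Rightarrow> 'v::ab_group_add \<Rightarrow> 'v) \<Rightarrow> ('i \<Rightarrow> 'v \<Rightarrow> 'v \<Rightarrow> 'k) \<Rightarrow> bool" where
  "simultaneously_orthogonalizable scale ip \<longleftrightarrow>
     (\<exists>B. \<not> Modules.module.dependent scale B \<and> Modules.module.span scale B = UNIV \<and>
          (\<forall>i. \<forall>v\<in>B. \<forall>w\<in>B. v \<noteq> w \<longrightarrow> ip i v w = 0))"

text \<open>
  A set of indices \<open>S\<close> belongs to \<open>U\<close> iff \<open>eventually (\<lambda>i. i \<in> S) U\<close>.
\<close>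

definition ultrafilter :: "'i filter \<Rightarrow> bool" where
  "ultrafilter U \<longleftrightarrow> U \<noteq> bot \<and> (\<forall>P. eventually P U \<or> eventually (\<lambda>i. \<not> P i) U)"

definition finite_dimensional_subspace ::
  "('k::field \<Rightarrow> 'v::ab_group_add \<Rightarrow> 'v) \<Rightarrow> 'v set \<Rightarrow> bool" where
  "finite_dimensional_subspace scale S \<longleftrightarrow>
     Modules.module.subspace scale S \<and> (\<exists>B. finite B \<and> Modules.module.span scale B = S)"

definition path_elements ::
  "('k::field \<Rightarrow> 'v::ab_group_add \<Rightarrow> 'v) \<Rightarrow> ('i \<Rightarrow> 'v \<Rightarrow> 'v \<Rightarrow> 'k) \<Rightarrow> 'i filter \<Rightarrow> 'v set" where
  "path_elements scale ip U =
     {x. \<forall>S. finite_dimensional_subspace scale S \<longrightarrow> eventually (\<lambda>i. \<forall>y\<in>S. ip i x y = 0) U}"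

definition nonpathological ::
  "('k::field \<Rightarrow> 'v::ab_group_add \<Rightarrow> 'v) \<Rightarrow> ('i \<Rightarrow> 'v \<Rightarrow> 'v \<Rightarrow> 'k) \<Rightarrow> 'i filter \<Rightarrow> bool" where
  "nonpathological scale ip U \<longleftrightarrow> path_elements scale ip U = {0}"


section \<open>The ultrapower of a field\<close>

definition ultra_rel :: "'i filter \<Rightarrow> (('i \<Rightarrow> 'k) \<times> ('i \<Rightarrow> 'k)) set" where
  "ultra_rel U = {(f, g). eventually (\<lambda>i. f i = g i) U}"

definition ultra_class :: "'i filter \<Rightarrow> ('i \<Rightarrow> 'k) \<Rightarrow> ('i \<Rightarrow> 'k) set" where
  "ultra_class U f = ultra_rel U `` {f}"

definition ultrapower :: "'i filter \<Rightarrow> ('i \<Rightarrow> 'k::field) set ring" where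
  "ultrapower U =
     \<lparr>carrier = UNIV // ultra_rel U,
      mult = (\<lambda>X Y. \<Union>f\<in>X. \<Union>g\<in>Y. ultra_class U (\<lambda>i. f i * g i)),
      one = ultra_class U (\<lambda>i. 1),
      zero = ultra_class U (\<lambda>i. 0),
      add = (\<lambda>X Y. \<Union>f\<in>X. \<Union>g\<in>Y. ultra_class U (\<lambda>i. f i + g i))\<rparr>"

definition ultra_const :: "'i filter \<Rightarrow> 'k \<Rightarrow> ('i \<Rightarrow> 'k) set" where
  "ultra_const U c = ultra_class U (\<lambda>i. c)"

lemma ultra_rel_equiv: "equiv UNIV (ultra_rel U)"
  unfolding ultra_rel_def
  by (auto intro!: equivI refl_onI symI transI elim: eventually_mono eventually_elim2)

lemma ultra_class_eq_iff: "ultra_class U f = ultra_class U g \<longleftrightarrow> eventually (\<lambda>i. f i = g i) U"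
  unfolding ultra_class_def using eq_equiv_class_iff[OF ultra_rel_equiv, of f g U]
  by (simp add: ultra_rel_def)

lemma ultra_class_mem: "g \<in> ultra_class U f \<longleftrightarrow> eventually (\<lambda>i. f i = g i) U"
  by (simp add: ultra_class_def ultra_rel_def)

lemma carrier_ultrapower: "carrier (ultrapower U) = range (ultra_class U)"
  by (auto simp: ultrapower_def quotient_def ultra_class_def)

lemma ultra_class_closed [simp]: "ultra_class U f \<in> carrier (ultrapower U)"
  by (simp add: carrier_ultrapower)

lemma ultra_class_binop:
  "(\<Union>f'\<in>ultra_class U f. \<Union>g'\<in>ultra_class U g. ultra_class U (\<lambda>i. h (f' i) (g' i)))
     = ultra_class U (\<lambda>i. h (f i) (g i))"
proof -
  have "ultra_class U (\<lambda>i. h (f' i) (g' i)) = ultra_class U (\<lambda>i. h (f i) (g i))"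
    if "f' \<in> ultra_class U f" "g' \<in> ultra_class U g" for f' g'
    using that unfolding ultra_class_mem ultra_class_eq_iff
    by (auto elim: eventually_elim2)
  moreover have "f \<in> ultra_class U f" "g \<in> ultra_class U g"
    by (simp_all add: ultra_class_mem)
  ultimately show ?thesis by blast
qed

lemma ultrapower_mult [simp]:
  "ultra_class U f \<otimes>\<^bsub>ultrapower U\<^esub> ultra_class U g = ultra_class U (\<lambda>i. f i * g i)"
  by (simp add: ultrapower_def ultra_class_binop)

lemma ultrapower_add [simp]:
  "ultra_class U f \<oplus>\<^bsub>ultrapower U\<^esub> ultra_class U g = ultra_class U (\<lambda>i. f i + g i)"
  by (simp add: ultrapower_def ultra_class_binop)

lemma ultrapower_one: "\<one>\<^bsub>ultrapower U\<^esub> = ultra_class U (\<lambda>i. 1)"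
  by (simp add: ultrapower_def)

lemma ultrapower_zero: "\<zero>\<^bsub>ultrapower U\<^esub> = ultra_class U (\<lambda>i. 0)"
  by (simp add: ultrapower_def)

lemma cring_ultrapower: "cring (ultrapower U)"
proof (rule cringI)
  show "abelian_group (ultrapower U)"
  proof (rule abelian_groupI)
    fix x assume "x \<in> carrier (ultrapower U)"
    then obtain f where x: "x = ultra_class U f" by (auto simp: carrier_ultrapower)
    have "ultra_class U (\<lambda>i. - f i) \<oplus>\<^bsub>ultrapower U\<^esub> x = \<zero>\<^bsub>ultrapower U\<^esub>"
      by (simp add: x ultrapower_zero)
    then show "\<exists>y\<in>carrier (ultrapower U). y \<oplus>\<^bsub>ultrapower U\<^esub> x = \<zero>\<^bsub>ultrapower U\<^esub>"
      by (meson ultra_class_closed)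
  qed (auto simp: carrier_ultrapower ultrapower_zero add_ac)
  show "comm_monoid (ultrapower U)"
    by (rule comm_monoidI) (auto simp: carrier_ultrapower ultrapower_one mult_ac)
qed (auto simp: carrier_ultrapower distrib_right)

lemma field_ultrapower:
  assumes "ultrafilter U"
  shows "Ring.field (ultrapower U)"
proof (rule cring.cring_fieldI2[OF cring_ultrapower])
  show "\<zero>\<^bsub>ultrapower U\<^esub> \<noteq> \<one>\<^bsub>ultrapower U\<^esub>"
    using assms
    by (simp add: ultrapower_zero ultrapower_one ultra_class_eq_iff ultrafilter_def eventually_False)
next
  fix a assume "a \<in> carrier (ultrapower U)" and nz: "a \<noteq> \<zero>\<^bsub>ultrapower U\<^esub>"
  then obtain f where a: "a = ultra_class U f" by (auto simp: carrier_ultrapower)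
  have "\<not> eventually (\<lambda>i. f i = 0) U"
    using nz by (simp add: a ultrapower_zero ultra_class_eq_iff)
  then have "eventually (\<lambda>i. f i \<noteq> 0) U"
    using assms unfolding ultrafilter_def by blast
  then have "eventually (\<lambda>i. f i * inverse (f i) = 1) U"
    by (auto elim: eventually_mono)
  then have "a \<otimes>\<^bsub>ultrapower U\<^esub> ultra_class U (\<lambda>i. inverse (f i)) = \<one>\<^bsub>ultrapower U\<^esub>"
    by (simp add: a ultrapower_one ultra_class_eq_iff)
  then show "\<exists>b\<in>carrier (ultrapower U). a \<otimes>\<^bsub>ultrapower U\<^esub> b = \<one>\<^bsub>ultrapower U\<^esub>"
    by (meson ultra_class_closed)
qed


section \<open>Extension of scalars\<close>

text \<open>
  For a ring \<open>F\<close> and a map \<open>\<iota>\<close> from the ground field to \<open>F\<close> (in use, a ring homomorphism),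
  \<open>V \<otimes> F\<close> is the free abelian group on \<open>V \<times> F\<close> modulo the usual relations.
\<close>

definition tensor_free :: "('f, 'm) ring_scheme \<Rightarrow> ('v \<times> 'f \<Rightarrow>\<^sub>0 int) monoid" where
  "tensor_free F = free_Abelian_group (UNIV \<times> carrier F)"

definition tensor_relators ::
  "('k \<Rightarrow> 'v::ab_group_add \<Rightarrow> 'v) \<Rightarrow> ('f, 'm) ring_scheme \<Rightarrow> ('k \<Rightarrow> 'f) \<Rightarrow>
   ('v \<times> 'f \<Rightarrow>\<^sub>0 int) set" where
  "tensor_relators scale F \<iota> =
     {frag_of (x + y, a) - frag_of (x, a) - frag_of (y, a) | x y a. a \<in> carrier F} \<union>
     {frag_of (x, a \<oplus>\<^bsub>F\<^esub> b) - frag_of (x, a) - frag_of (x, b) | x a b.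
        a \<in> carrier F \<and> b \<in> carrier F} \<union>
     {frag_of (scale c x, a) - frag_of (x, \<iota> c \<otimes>\<^bsub>F\<^esub> a) | c x a. a \<in> carrier F}"

definition tensor_subgroup ::
  "('k \<Rightarrow> 'v::ab_group_add \<Rightarrow> 'v) \<Rightarrow> ('f, 'm) ring_scheme \<Rightarrow> ('k \<Rightarrow> 'f) \<Rightarrow>
   ('v \<times> 'f \<Rightarrow>\<^sub>0 int) set" where
  "tensor_subgroup scale F \<iota> = generate (tensor_free F) (tensor_relators scale F \<iota>)"

definition pure_tensor ::
  "('k \<Rightarrow> 'v::ab_group_add \<Rightarrow> 'v) \<Rightarrow> ('f, 'm) ring_scheme \<Rightarrow> ('k \<Rightarrow> 'f) \<Rightarrow>
   'v \<Rightarrow> 'f \<Rightarrow> ('v \<times> 'f \<Rightarrow>\<^sub>0 int) set" where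
  "pure_tensor scale F \<iota> x a = tensor_subgroup scale F \<iota> #>\<^bsub>tensor_free F\<^esub> frag_of (x, a)"

text \<open>
  The \<open>mult\<close> and \<open>one\<close> fields of the module record have no meaning here.
  Scalar multiplication is induced by \<open>b (x \<otimes> a) = x \<otimes> b a\<close>; multiplying the image
  of a coset by the subgroup yields again a full coset.
\<close>

definition scalar_extension ::
  "('k \<Rightarrow> 'v::ab_group_add \<Rightarrow> 'v) \<Rightarrow> ('f, 'm) ring_scheme \<Rightarrow> ('k \<Rightarrow> 'f) \<Rightarrow>
   ('f, ('v \<times> 'f \<Rightarrow>\<^sub>0 int) set) module" where
  "scalar_extension scale F \<iota> =
     (let Q = tensor_free F Mod tensor_subgroup scale F \<iota> in
      \<lparr>carrier = carrier Q, mult = undefined, one = undefined,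
       zero = one Q, add = mult Q,
       smult = (\<lambda>b X. tensor_subgroup scale F \<iota> <#>\<^bsub>tensor_free F\<^esub>
                        frag_extend (\<lambda>(x, a). frag_of (x, b \<otimes>\<^bsub>F\<^esub> a)) ` X)\<rparr>)"

text \<open>The value at \<open>c\<close> of the homomorphism from a free abelian group that extends \<open>f\<close>.\<close>

definition frag_eval :: "('b, 'm) monoid_scheme \<Rightarrow> ('a \<Rightarrow> 'b) \<Rightarrow> ('a \<Rightarrow>\<^sub>0 int) \<Rightarrow> 'b" where
  "frag_eval G f c = finprod G (\<lambda>p. f p [^]\<^bsub>G\<^esub> Poly_Mapping.lookup c p) (Poly_Mapping.keys c)"

text \<open>
  The form on \<open>V \<otimes> F\<close> induced by \<open>(x \<otimes> a, y \<otimes> b) \<mapsto> a b \<beta>(x, y)\<close>, computed on representatives;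
  see \<open>extended_form_pure\<close> and \<open>inner_product_extended_form\<close> below.
\<close>

definition free_form ::
  "('f, 'm) ring_scheme \<Rightarrow> ('v \<Rightarrow> 'v \<Rightarrow> 'f) \<Rightarrow> ('v \<times> 'f \<Rightarrow>\<^sub>0 int) \<Rightarrow> ('v \<times> 'f \<Rightarrow>\<^sub>0 int) \<Rightarrow> 'f" where
  "free_form F \<beta> s t =
     frag_eval (add_monoid F)
       (\<lambda>(x, a). frag_eval (add_monoid F) (\<lambda>(y, b). a \<otimes>\<^bsub>F\<^esub> b \<otimes>\<^bsub>F\<^esub> \<beta> x y) t) s"

definition extended_form ::
  "('f, 'm) ring_scheme \<Rightarrow> ('v \<Rightarrow> 'v \<Rightarrow> 'f) \<Rightarrow>
   ('v \<times> 'f \<Rightarrow>\<^sub>0 int) set \<Rightarrow> ('v \<times> 'f \<Rightarrow>\<^sub>0 int) set \<Rightarrow> 'f" where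
  "extended_form F \<beta> X Y = the_elem {free_form F \<beta> s t | s t. s \<in> X \<and> t \<in> Y}"

definition module_inner_product ::
  "('f, 'm) ring_scheme \<Rightarrow> ('f, 'w, 'n) module_scheme \<Rightarrow> ('w \<Rightarrow> 'w \<Rightarrow> 'f) \<Rightarrow> bool" where
  "module_inner_product R M B \<longleftrightarrow>
     (\<forall>x\<in>carrier M. \<forall>y\<in>carrier M. B x y \<in> carrier R \<and> B x y = B y x) \<and>
     (\<forall>x\<in>carrier M. \<forall>y\<in>carrier M. \<forall>z\<in>carrier M. B x (y \<oplus>\<^bsub>M\<^esub> z) = B x y \<oplus>\<^bsub>R\<^esub> B x z) \<and>
     (\<forall>x\<in>carrier M. \<forall>y\<in>carrier M. \<forall>a\<in>carrier R. B x (a \<odot>\<^bsub>M\<^esub> y) = a \<otimes>\<^bsub>R\<^esub> B x y)"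

definition radical ::
  "('f, 'm) ring_scheme \<Rightarrow> ('f, 'w, 'n) module_scheme \<Rightarrow> ('w \<Rightarrow> 'w \<Rightarrow> 'f) \<Rightarrow> 'w set" where
  "radical R M B = {x \<in> carrier M. \<forall>y\<in>carrier M. B x y = \<zero>\<^bsub>R\<^esub>}"

definition nondegenerate ::
  "('f, 'm) ring_scheme \<Rightarrow> ('f, 'w, 'n) module_scheme \<Rightarrow> ('w \<Rightarrow> 'w \<Rightarrow> 'f) \<Rightarrow> bool" where
  "nondegenerate R M B \<longleftrightarrow> radical R M B = {\<zero>\<^bsub>M\<^esub>}"

lemma frag_eval_hom:
  assumes "comm_group G" "\<And>p. p \<in> S \<Longrightarrow> f p \<in> carrier G"
  shows "frag_eval G f \<in> hom (free_Abelian_group S) G"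
proof (rule homI)
  interpret comm_group G by fact
  have ext: "frag_eval G f c = finprod G (\<lambda>p. f p [^]\<^bsub>G\<^esub> Poly_Mapping.lookup c p) T"
    if "Poly_Mapping.keys c \<subseteq> T" "finite T" "T \<subseteq> S" for c T
    unfolding frag_eval_def using that assms(2)
    by (intro finprod_mono_neutral_cong_left) (auto simp: in_keys_iff)
  show "frag_eval G f c \<in> carrier G" if "c \<in> carrier (free_Abelian_group S)" for c
    using that assms(2) unfolding frag_eval_def by (intro finprod_closed) auto
  fix c d assume "c \<in> carrier (free_Abelian_group S)" "d \<in> carrier (free_Abelian_group S)"
  then have cd: "Poly_Mapping.keys c \<subseteq> S" "Poly_Mapping.keys d \<subseteq> S" by auto
  let ?T = "Poly_Mapping.keys c \<union> Poly_Mapping.keys d"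
  have f: "f p \<in> carrier G" if "p \<in> ?T" for p using that cd assms(2) by auto
  have "frag_eval G f (c + d) = finprod G (\<lambda>p. f p [^]\<^bsub>G\<^esub> Poly_Mapping.lookup (c + d) p) ?T"
    using cd keys_add[of c d] by (intro ext) auto
  also have "\<dots> = finprod G (\<lambda>p. f p [^]\<^bsub>G\<^esub> Poly_Mapping.lookup c p \<otimes>\<^bsub>G\<^esub>
                                f p [^]\<^bsub>G\<^esub> Poly_Mapping.lookup d p) ?T"
    using f by (intro finprod_cong') (auto simp: lookup_add int_pow_mult)
  also have "\<dots> = frag_eval G f c \<otimes>\<^bsub>G\<^esub> frag_eval G f d"
    using f cd by (subst (1 2) ext[where T = ?T]) (auto intro!: finprod_multf)
  finally show "frag_eval G f (c \<otimes>\<^bsub>free_Abelian_group S\<^esub> d) = frag_eval G f c \<otimes>\<^bsub>G\<^esub> frag_eval G f d"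
    by simp
qed

lemma frag_eval_frag_of:
  assumes "comm_group G" "f p \<in> carrier G"
  shows "frag_eval G f (frag_of p) = f p"
proof -
  interpret comm_group G by fact
  show ?thesis using assms(2) by (simp add: frag_eval_def finprod_singleton)
qed

locale scalar_ext = cring F
  for F :: "('f, 'm) ring_scheme" (structure)
    and scale :: "'k \<Rightarrow> 'v::ab_group_add \<Rightarrow> 'v" and \<iota> :: "'k \<Rightarrow> 'f" +
  assumes \<iota>_closed [simp]: "\<iota> c \<in> carrier F"
begin

abbreviation "G \<equiv> tensor_free F :: ('v \<times> 'f \<Rightarrow>\<^sub>0 int) monoid"
abbreviation "N \<equiv> tensor_subgroup scale F \<iota>"
abbreviation "M \<equiv> scalar_extension scale F \<iota>"

sublocale G: comm_group G
  unfolding tensor_free_def by (rule abelian_free_Abelian_group)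

lemma G_mult [simp]: "x \<otimes>\<^bsub>G\<^esub> y = x + y"
  and G_one [simp]: "\<one>\<^bsub>G\<^esub> = 0"
  and G_carrier: "x \<in> carrier G \<longleftrightarrow> Poly_Mapping.keys x \<subseteq> UNIV \<times> carrier F"
  by (simp_all add: tensor_free_def)

lemma G_frag_of [simp]: "frag_of (x, a) \<in> carrier G \<longleftrightarrow> a \<in> carrier F"
  by (simp add: G_carrier)

lemma G_inv: "x \<in> carrier G \<Longrightarrow> inv\<^bsub>G\<^esub> x = - x"
  by (simp add: tensor_free_def)

lemma G_diff [simp]: "x \<in> carrier G \<Longrightarrow> y \<in> carrier G \<Longrightarrow> x - y \<in> carrier G"
  by (metis G.inv_closed G.m_closed G_inv G_mult diff_conv_add_uminus)

lemma relators_carrier: "tensor_relators scale F \<iota> \<subseteq> carrier G"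
  unfolding tensor_relators_def by auto

lemma subgroup_N: "subgroup N G"
  unfolding tensor_subgroup_def by (rule G.generate_is_subgroup[OF relators_carrier])

sublocale N: normal N G
  by (rule G.subgroup_imp_normal[OF subgroup_N])

lemma relators_N: "r \<in> tensor_relators scale F \<iota> \<Longrightarrow> r \<in> N"
  unfolding tensor_subgroup_def by (rule generate.incl)

lemma hom_kills_N:
  assumes "h \<in> hom G H" "group H" "\<And>r. r \<in> tensor_relators scale F \<iota> \<Longrightarrow> h r = \<one>\<^bsub>H\<^esub>" "n \<in> N"
  shows "h n = \<one>\<^bsub>H\<^esub>"
proof -
  interpret h: group_hom G H h
    using assms by (simp add: group_hom_def group_hom_axioms_def G.is_group)
  have "N \<subseteq> kernel G H h"
    unfolding tensor_subgroup_def
    by (rule G.generate_subgroup_incl[OF _ h.subgroup_kernel])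
       (use assms(3) relators_carrier in \<open>auto simp: kernel_def\<close>)
  then show ?thesis using assms(4) by (auto simp: kernel_def)
qed

lemma coset_eq_iff:
  assumes "s \<in> carrier G" "t \<in> carrier G"
  shows "N #>\<^bsub>G\<^esub> s = N #>\<^bsub>G\<^esub> t \<longleftrightarrow> s - t \<in> N"
proof -
  have "s - t \<in> N \<longleftrightarrow> s \<in> N #>\<^bsub>G\<^esub> t"
    by (auto simp: r_coset_def) (metis diff_add_cancel)
  then show ?thesis
    using G.repr_independence[OF _ assms(2) subgroup_N, of s] G.rcos_self[OF assms(1) subgroup_N]
    by auto
qed

lemma coset_mem: "s \<in> carrier G \<Longrightarrow> s' \<in> N #>\<^bsub>G\<^esub> s \<longleftrightarrow> s' - s \<in> N"
  by (auto simp: r_coset_def) (metis diff_add_cancel)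

lemma carrier_M: "carrier M = (\<lambda>s. N #>\<^bsub>G\<^esub> s) ` carrier G"
  by (simp add: scalar_extension_def Let_def carrier_FactGroup)

lemma zero_M: "\<zero>\<^bsub>M\<^esub> = N #>\<^bsub>G\<^esub> 0"
  using G.coset_mult_one[of N] N.subset by (simp add: scalar_extension_def Let_def)

lemma add_M:
  "s \<in> carrier G \<Longrightarrow> t \<in> carrier G \<Longrightarrow> (N #>\<^bsub>G\<^esub> s) \<oplus>\<^bsub>M\<^esub> (N #>\<^bsub>G\<^esub> t) = N #>\<^bsub>G\<^esub> (s + t)"
  using N.rcos_sum by (simp add: scalar_extension_def Let_def)

definition act :: "'f \<Rightarrow> ('v \<times> 'f \<Rightarrow>\<^sub>0 int) \<Rightarrow> ('v \<times> 'f \<Rightarrow>\<^sub>0 int)" where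
  "act b = frag_extend (\<lambda>(x, a). frag_of (x, b \<otimes> a))"

lemma act_simps [simp]:
  "act b (frag_of (x, a)) = frag_of (x, b \<otimes> a)"
  "act b (s + t) = act b s + act b t"
  "act b (s - t) = act b s - act b t"
  "act b 0 = 0"
  by (simp_all add: act_def frag_extend_add frag_extend_diff)

lemma act_closed [simp]: "b \<in> carrier F \<Longrightarrow> s \<in> carrier G \<Longrightarrow> act b s \<in> carrier G"
  unfolding G_carrier act_def
  by (rule order_trans[OF keys_frag_extend]) auto

lemma act_hom: "b \<in> carrier F \<Longrightarrow> act b \<in> hom G G"
  by (rule homI) auto

lemma act_N:
  assumes b: "b \<in> carrier F" and "n \<in> N"
  shows "act b n \<in> N"
proof -
  have "(\<lambda>s. N #>\<^bsub>G\<^esub> act b s) n = \<one>\<^bsub>G Mod N\<^esub>"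
  proof (rule hom_kills_N[OF _ N.factorgroup_is_group _ assms(2)])
    have "(\<lambda>s. N #>\<^bsub>G\<^esub> s) \<circ> act b \<in> hom G (G Mod N)"
      by (rule Group.hom_compose[OF act_hom[OF b] N.r_coset_hom_Mod])
    then show "(\<lambda>s. N #>\<^bsub>G\<^esub> act b s) \<in> hom G (G Mod N)" by (simp add: o_def)
    fix r assume r: "r \<in> tensor_relators scale F \<iota>"
    have "act b r \<in> tensor_relators scale F \<iota>"
      using r unfolding tensor_relators_def
    proof (elim UnE CollectE exE conjE, goal_cases)
      case (1 x y a)
      then show ?case using b by (intro UnI1) auto
    next
      case (2 x a c)
      then have "act b r = frag_of (x, b \<otimes> a \<oplus> b \<otimes> c) - frag_of (x, b \<otimes> a) - frag_of (x, b \<otimes> c)"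
        using b by (simp add: r_distr)
      then show ?case using b 2 m_closed by blast
    next
      case (3 c x a)
      then have "act b r = frag_of (scale c x, b \<otimes> a) - frag_of (x, \<iota> c \<otimes> (b \<otimes> a))"
        using b by (simp add: m_lcomm)
      then show ?case using b 3 m_closed by blast
    qed
    then show "N #>\<^bsub>G\<^esub> act b r = \<one>\<^bsub>G Mod N\<^esub>"
      using N.rcos_const relators_N by simp
  qed
  moreover have "act b n \<in> carrier G"
    using assms N.subset by auto
  ultimately show ?thesis
    using G.rcos_self[OF _ subgroup_N] by fastforce
qed

lemma smult_M:
  assumes b: "b \<in> carrier F" and s: "s \<in> carrier G"
  shows "b \<odot>\<^bsub>M\<^esub> (N #>\<^bsub>G\<^esub> s) = N #>\<^bsub>G\<^esub> act b s"
proof -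
  have "b \<odot>\<^bsub>M\<^esub> (N #>\<^bsub>G\<^esub> s) = N <#>\<^bsub>G\<^esub> act b ` (N #>\<^bsub>G\<^esub> s)"
    by (simp add: scalar_extension_def Let_def act_def)
  also have "\<dots> = N #>\<^bsub>G\<^esub> act b s"
  proof (intro equalityI subsetI)
    fix z assume "z \<in> N <#>\<^bsub>G\<^esub> act b ` (N #>\<^bsub>G\<^esub> s)"
    then obtain n n' where "n \<in> N" "n' \<in> N" "z = (n + act b n') + act b s"
      by (auto simp: set_mult_def r_coset_def add.assoc)
    moreover from this have "n + act b n' \<in> N"
      using act_N[OF b] N.m_closed[of n "act b n'"] by simp
    ultimately show "z \<in> N #>\<^bsub>G\<^esub> act b s" by (auto simp: r_coset_def)
  next
    fix z assume "z \<in> N #>\<^bsub>G\<^esub> act b s"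
    then obtain n where "n \<in> N" "z = n + act b s" by (auto simp: r_coset_def)
    then show "z \<in> N <#>\<^bsub>G\<^esub> act b ` (N #>\<^bsub>G\<^esub> s)"
      using G.rcos_self[OF s subgroup_N] by (auto simp: set_mult_def)
  qed
  finally show ?thesis .
qed

lemma G_eq_coset:
  assumes "s \<in> carrier G" "t \<in> carrier G" "s - t \<in> N"
  shows "N #>\<^bsub>G\<^esub> s = N #>\<^bsub>G\<^esub> t"
  using assms coset_eq_iff by blast

abbreviation "pt \<equiv> pure_tensor scale F \<iota>"

lemma pure_tensor_closed [simp]: "a \<in> carrier F \<Longrightarrow> pt x a \<in> carrier M"
  by (simp add: pure_tensor_def carrier_M)

lemma smult_pure_tensor:
  "a \<in> carrier F \<Longrightarrow> b \<in> carrier F \<Longrightarrow> b \<odot>\<^bsub>M\<^esub> pt x a = pt x (b \<otimes> a)"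
  by (simp add: pure_tensor_def smult_M)

lemma pure_tensor_add_left:
  assumes "a \<in> carrier F"
  shows "pt (x + y) a = pt x a \<oplus>\<^bsub>M\<^esub> pt y a"
proof -
  have "frag_of (x + y, a) - (frag_of (x, a) + frag_of (y, a)) \<in> N"
    using assms by (intro relators_N) (auto simp: tensor_relators_def diff_diff_eq)
  moreover have "frag_of (x, a) + frag_of (y, a) \<in> carrier G"
    using assms G.m_closed[of "frag_of (x, a)" "frag_of (y, a)"] by simp
  ultimately show ?thesis
    using assms by (simp add: pure_tensor_def add_M coset_eq_iff)
qed

lemma pure_tensor_add_right:
  assumes "a \<in> carrier F" "b \<in> carrier F"
  shows "pt x (a \<oplus> b) = pt x a \<oplus>\<^bsub>M\<^esub> pt x b"
proof -
  have "frag_of (x, a \<oplus> b) - (frag_of (x, a) + frag_of (x, b)) \<in> N"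
    using assms by (intro relators_N) (auto simp: tensor_relators_def diff_diff_eq)
  moreover have "frag_of (x, a) + frag_of (x, b) \<in> carrier G"
    using assms G.m_closed[of "frag_of (x, a)" "frag_of (x, b)"] by simp
  ultimately show ?thesis
    using assms by (simp add: pure_tensor_def add_M coset_eq_iff)
qed

lemma pure_tensor_scale:
  assumes "a \<in> carrier F"
  shows "pt (scale c x) a = pt x (\<iota> c \<otimes> a)"
proof -
  have "frag_of (scale c x, a) - frag_of (x, \<iota> c \<otimes> a) \<in> N"
    using assms by (intro relators_N) (auto simp: tensor_relators_def)
  then show ?thesis
    using assms by (simp add: pure_tensor_def coset_eq_iff)
qed

lemma G_induct [consumes 1, case_names zero of diff]:
  assumes "s \<in> carrier G" "P 0" "\<And>x a. a \<in> carrier F \<Longrightarrow> P (frag_of (x, a))"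
    "\<And>s t. s \<in> carrier G \<Longrightarrow> t \<in> carrier G \<Longrightarrow> P s \<Longrightarrow> P t \<Longrightarrow> P (s - t)"
  shows "P s"
  using assms(1) unfolding G_carrier
  by (rule free_Abelian_group_induct) (use assms(2-) in \<open>auto simp: G_carrier\<close>)

lemma module_M: "Module.module F M"
proof (rule moduleI)
  have cl: "s + t \<in> carrier G" if "s \<in> carrier G" "t \<in> carrier G" for s t
    using that G.m_closed by fastforce
  have z: "0 \<in> carrier G" using G.one_closed by simp
  show "cring F" by (rule is_cring)
  show "abelian_group M"
  proof (rule abelian_groupI)
    fix X assume "X \<in> carrier M"
    then obtain s where s: "s \<in> carrier G" "X = N #>\<^bsub>G\<^esub> s" by (auto simp: carrier_M)
    then have "- s \<in> carrier G" using G.inv_closed[of s] by (simp add: G_inv)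
    then show "\<exists>Y\<in>carrier M. Y \<oplus>\<^bsub>M\<^esub> X = \<zero>\<^bsub>M\<^esub>"
      using s by (intro bexI[of _ "N #>\<^bsub>G\<^esub> (- s)"]) (auto simp: carrier_M add_M zero_M)
  qed (auto simp: carrier_M add_M zero_M cl z add_ac)
  fix X assume "X \<in> carrier M"
  then obtain s where s: "s \<in> carrier G" "X = N #>\<^bsub>G\<^esub> s" by (auto simp: carrier_M)
  show "\<one> \<odot>\<^bsub>M\<^esub> X = X"
  proof -
    from s(1) have "act \<one> s = s" by (induction rule: G_induct) auto
    then show ?thesis using s by (simp add: smult_M)
  qed
  fix a assume a: "a \<in> carrier F"
  show "a \<odot>\<^bsub>M\<^esub> X \<in> carrier M" using a s by (auto simp: smult_M carrier_M)
  { fix Y assume "Y \<in> carrier M"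
    then obtain t where t: "t \<in> carrier G" "Y = N #>\<^bsub>G\<^esub> t" by (auto simp: carrier_M)
    show "a \<odot>\<^bsub>M\<^esub> (X \<oplus>\<^bsub>M\<^esub> Y) = a \<odot>\<^bsub>M\<^esub> X \<oplus>\<^bsub>M\<^esub> a \<odot>\<^bsub>M\<^esub> Y"
      using a s t by (simp add: smult_M add_M cl) }
  fix b assume b: "b \<in> carrier F"
  show "(a \<otimes> b) \<odot>\<^bsub>M\<^esub> X = a \<odot>\<^bsub>M\<^esub> (b \<odot>\<^bsub>M\<^esub> X)"
  proof -
    from s(1) have "act (a \<otimes> b) s = act a (act b s)"
      by (induction rule: G_induct) (auto simp: a b m_assoc)
    then show ?thesis using s a b by (simp add: smult_M)
  qed
  show "(a \<oplus> b) \<odot>\<^bsub>M\<^esub> X = a \<odot>\<^bsub>M\<^esub> X \<oplus>\<^bsub>M\<^esub> b \<odot>\<^bsub>M\<^esub> X"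
  proof -
    from s(1) have "act (a \<oplus> b) s - (act a s + act b s) \<in> N"
    proof (induction rule: G_induct)
      case zero
      then show ?case using N.one_closed by simp
    next
      case (of x c)
      then show ?case using a b
        by (intro relators_N) (auto simp: tensor_relators_def l_distr diff_diff_eq)
    next
      case (diff s t)
      have "act (a \<oplus> b) (s - t) - (act a (s - t) + act b (s - t)) =
        (act (a \<oplus> b) s - (act a s + act b s)) \<otimes>\<^bsub>G\<^esub> inv\<^bsub>G\<^esub> (act (a \<oplus> b) t - (act a t + act b t))"
        using diff a b by (subst G_inv) (auto simp: cl)
      then show ?case using diff N.m_closed N.m_inv_closed by presburger
    qed
    then show ?thesis
      using s a b by (simp add: smult_M add_M coset_eq_iff cl)
  qed
qed

end

locale scalar_ext_form = scalar_ext F scale \<iota>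
  for F :: "('f, 'm) ring_scheme" (structure)
    and scale :: "'k \<Rightarrow> 'v::ab_group_add \<Rightarrow> 'v" and \<iota> :: "'k \<Rightarrow> 'f" +
  fixes \<beta> :: "'v \<Rightarrow> 'v \<Rightarrow> 'f"
  assumes \<beta>_closed [simp]: "\<beta> x y \<in> carrier F"
    and \<beta>_sym: "\<beta> x y = \<beta> y x"
    and \<beta>_add: "\<beta> (x + y) z = \<beta> x z \<oplus> \<beta> y z"
    and \<beta>_scale: "\<beta> (scale c x) z = \<iota> c \<otimes> \<beta> x z"
begin

lemma A: "comm_group (add_monoid F)"
  by (rule a_comm_group)

lemma frag_eval_G:
  assumes "\<And>x a. a \<in> carrier F \<Longrightarrow> f (x, a) \<in> carrier F"
  shows "frag_eval (add_monoid F) f \<in> hom G (add_monoid F)"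
  unfolding tensor_free_def by (rule frag_eval_hom[OF A]) (use assms in auto)

lemma hom_A:
  assumes "h \<in> hom G (add_monoid F)"
  shows "s \<in> carrier G \<Longrightarrow> h s \<in> carrier F"
    "s \<in> carrier G \<Longrightarrow> t \<in> carrier G \<Longrightarrow> h (s + t) = h s \<oplus> h t"
    "s \<in> carrier G \<Longrightarrow> t \<in> carrier G \<Longrightarrow> h (s - t) = h s \<ominus> h t"
    "h 0 = \<zero>"
proof -
  interpret h: group_hom G "add_monoid F" h
    using assms A by (simp add: group_hom_def group_hom_axioms_def G.is_group comm_group_def)
  show "h s \<in> carrier F" if "s \<in> carrier G"
    using h.hom_closed[OF that] by simp
  show "h (s + t) = h s \<oplus> h t" if "s \<in> carrier G" "t \<in> carrier G"
    using h.hom_mult[OF that] by simp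
  show "h (s - t) = h s \<ominus> h t" if "s \<in> carrier G" "t \<in> carrier G"
    using h.hom_mult[OF that(1) G.inv_closed[OF that(2)]] h.hom_inv[OF that(2)] that
    by (simp add: G_inv a_minus_def a_inv_def)
  show "h 0 = \<zero>" using h.hom_one by simp
qed

lemma inner_hom:
  assumes "a \<in> carrier F"
  shows "frag_eval (add_monoid F) (\<lambda>(y, b). a \<otimes> b \<otimes> \<beta> x y) \<in> hom G (add_monoid F)"
  by (rule frag_eval_G) (use assms in auto)

lemma free_form_of:
  assumes "a \<in> carrier F" "b \<in> carrier F"
  shows "free_form F \<beta> (frag_of (x, a)) (frag_of (y, b)) = a \<otimes> b \<otimes> \<beta> x y"
  using assms unfolding free_form_def
  by (simp add: frag_eval_frag_of[OF A])

lemma free_form_hom_left: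
  assumes "t \<in> carrier G"
  shows "(\<lambda>s. free_form F \<beta> s t) \<in> hom G (add_monoid F)"
proof -
  have "(\<lambda>s. free_form F \<beta> s t) =
    frag_eval (add_monoid F) (\<lambda>(x, a). frag_eval (add_monoid F) (\<lambda>(y, b). a \<otimes> b \<otimes> \<beta> x y) t)"
    by (simp add: free_form_def fun_eq_iff)
  then show ?thesis
    by (simp only:) (rule frag_eval_G, use hom_A(1)[OF inner_hom assms] in simp)
qed

lemma free_form_of_left:
  assumes "a \<in> carrier F" "t \<in> carrier G"
  shows "free_form F \<beta> (frag_of (x, a)) t = frag_eval (add_monoid F) (\<lambda>(y, b). a \<otimes> b \<otimes> \<beta> x y) t"
  using assms hom_A(1)[OF inner_hom assms(2)] unfolding free_form_def
  by (simp add: frag_eval_frag_of[OF A])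

lemma free_form_closed [simp]:
  "s \<in> carrier G \<Longrightarrow> t \<in> carrier G \<Longrightarrow> free_form F \<beta> s t \<in> carrier F"
  using hom_A(1)[OF free_form_hom_left] by simp

lemma free_form_add_right:
  assumes s: "s \<in> carrier G" and t: "t \<in> carrier G" "t' \<in> carrier G"
  shows "free_form F \<beta> s (t + t') = free_form F \<beta> s t \<oplus> free_form F \<beta> s t'"
proof -
  have tt: "t + t' \<in> carrier G" using t G.m_closed by fastforce
  note L = hom_A[OF free_form_hom_left]
  from s show ?thesis
  proof (induction rule: G_induct)
    case zero
    then show ?case using t tt by (simp add: L(4))
  next
    case (of x a)
    then show ?case
      using t tt by (simp add: free_form_of_left hom_A(2)[OF inner_hom])
  next
    case (diff s s')
    then show ?case
      using t tt by (simp add: L(3) minus_eq minus_add a_ac)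
  qed
qed

lemma free_form_hom_right:
  assumes "s \<in> carrier G"
  shows "free_form F \<beta> s \<in> hom G (add_monoid F)"
  by (rule homI) (use assms in \<open>auto simp: free_form_add_right\<close>)

lemma free_form_sym:
  assumes "s \<in> carrier G" "t \<in> carrier G"
  shows "free_form F \<beta> s t = free_form F \<beta> t s"
  using assms
proof (induction s rule: G_induct)
  case zero
  then show ?case by (simp add: hom_A(4)[OF free_form_hom_left] hom_A(4)[OF free_form_hom_right])
next
  case (of x a)
  note xa = of
  from of(2) show ?case
  proof (induction t rule: G_induct)
    case zero
    then show ?case
      using xa by (simp add: hom_A(4)[OF free_form_hom_left] hom_A(4)[OF free_form_hom_right])
  next
    case (of y b)
    then show ?case using xa by (simp add: free_form_of \<beta>_sym m_comm)
  next
    case (diff t t')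
    then show ?case
      using xa by (simp add: hom_A(3)[OF free_form_hom_left] hom_A(3)[OF free_form_hom_right])
  qed
next
  case (diff s s')
  then show ?case
    by (simp add: hom_A(3)[OF free_form_hom_left] hom_A(3)[OF free_form_hom_right])
qed

lemma free_form_act:
  assumes "c \<in> carrier F" "s \<in> carrier G" "t \<in> carrier G"
  shows "free_form F \<beta> (act c s) t = c \<otimes> free_form F \<beta> s t"
  using assms(2,3)
proof (induction s rule: G_induct)
  case zero
  then show ?case using assms(1) by (simp add: hom_A(4)[OF free_form_hom_left])
next
  case (of x a)
  note xa = of
  from of(2) show ?case
  proof (induction t rule: G_induct)
    case zero
    then show ?case
      using xa assms(1) by (simp add: hom_A(4)[OF free_form_hom_right])
  next
    case (of y b)
    then show ?case using xa assms(1) by (simp add: free_form_of m_ac)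
  next
    case (diff t t')
    then show ?case
      using xa assms(1) by (simp add: hom_A(3)[OF free_form_hom_right] minus_eq r_distr r_minus)
  qed
next
  case (diff s s')
  then show ?case
    using assms(1) by (simp add: hom_A(3)[OF free_form_hom_left] minus_eq r_distr r_minus)
qed

lemma free_form_relator:
  assumes r: "r \<in> tensor_relators scale F \<iota>" and t: "t \<in> carrier G"
  shows "free_form F \<beta> r t = \<zero>"
  using t
proof (induction t rule: G_induct)
  case zero
  then show ?case using r relators_carrier by (auto simp: hom_A(4)[OF free_form_hom_right])
next
  case (of z d)
  note L = hom_A[OF free_form_hom_left]
  have rn: "u \<ominus> v \<ominus> w = \<zero>" if "u = v \<oplus> w" "v \<in> carrier F" "w \<in> carrier F" for u v w
    using that r_neg[of "v \<oplus> w"] by (simp add: minus_eq minus_add a_assoc)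
  from r show ?case unfolding tensor_relators_def
  proof (elim UnE CollectE exE conjE, goal_cases)
    case (1 x y a)
    show ?case unfolding 1(1) using 1(2) of
      by (simp add: L(3) free_form_of \<beta>_add rn r_distr)
  next
    case (2 x a b)
    show ?case unfolding 2(1) using 2(2,3) of
      by (simp add: L(3) free_form_of rn l_distr)
  next
    case (3 c x a)
    show ?case unfolding 3(1) using 3(2) of
      by (simp add: L(3) free_form_of \<beta>_scale minus_eq m_ac r_neg)
  qed
next
  case (diff t t')
  then show ?case
    using r relators_carrier by (auto simp: hom_A(3)[OF free_form_hom_right] minus_eq)
qed

lemma free_form_N:
  assumes "n \<in> N" "t \<in> carrier G"
  shows "free_form F \<beta> n t = \<zero>"
  using hom_kills_N[OF free_form_hom_left[OF assms(2)] _ _ assms(1)] A free_form_relator assms(2)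
  by (simp add: comm_group_def)

lemma free_form_coset:
  assumes "s \<in> carrier G" "t \<in> carrier G" "s' \<in> N #>\<^bsub>G\<^esub> s"
  shows "free_form F \<beta> s' t = free_form F \<beta> s t"
proof -
  obtain n where n: "n \<in> N" "s' = n + s" using assms(3) by (auto simp: r_coset_def)
  then have "n \<in> carrier G" using N.subset by auto
  then show ?thesis
    using n assms(1,2) by (simp add: hom_A(2)[OF free_form_hom_left] free_form_N)
qed

lemma extended_form_coset:
  assumes s: "s \<in> carrier G" and t: "t \<in> carrier G"
  shows "extended_form F \<beta> (N #>\<^bsub>G\<^esub> s) (N #>\<^bsub>G\<^esub> t) = free_form F \<beta> s t"
proof -
  have "free_form F \<beta> s' t' = free_form F \<beta> s t" if "s' \<in> N #>\<^bsub>G\<^esub> s" "t' \<in> N #>\<^bsub>G\<^esub> t" for s' t'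
  proof -
    have t': "t' \<in> carrier G" using that(2) t G.r_coset_subset_G[OF N.subset t] by auto
    have "free_form F \<beta> s' t' = free_form F \<beta> s t'" using free_form_coset[OF s t' that(1)] .
    also have "\<dots> = free_form F \<beta> t' s" using free_form_sym[OF s t'] .
    also have "\<dots> = free_form F \<beta> t s" using free_form_coset[OF t s that(2)] .
    finally show ?thesis using free_form_sym[OF s t] by simp
  qed
  then have "{free_form F \<beta> s' t' | s' t'. s' \<in> N #>\<^bsub>G\<^esub> s \<and> t' \<in> N #>\<^bsub>G\<^esub> t} = {free_form F \<beta> s t}"
    using G.rcos_self[OF s subgroup_N] G.rcos_self[OF t subgroup_N] by blast
  then show ?thesis by (simp add: extended_form_def)
qed

lemma extended_form_pure:
  assumes "a \<in> carrier F" "b \<in> carrier F"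
  shows "extended_form F \<beta> (pt x a) (pt y b) = a \<otimes> b \<otimes> \<beta> x y"
  using assms by (simp add: pure_tensor_def extended_form_coset free_form_of)

lemma inner_product_extended_form: "module_inner_product F M (extended_form F \<beta>)"
proof -
  have cl: "s + t \<in> carrier G" if "s \<in> carrier G" "t \<in> carrier G" for s t
    using that G.m_closed by fastforce
  have act: "free_form F \<beta> s (act a t) = a \<otimes> free_form F \<beta> s t"
    if "s \<in> carrier G" "t \<in> carrier G" "a \<in> carrier F" for s t a
    using that free_form_act free_form_sym act_closed by metis
  show ?thesis
    unfolding module_inner_product_def
    by (auto simp: carrier_M extended_form_coset add_M smult_M cl act free_form_add_right
        intro: free_form_sym)
qed

end


section \<open>The form induced by a family of inner products\<close>

definition ultra_form :: "('i \<Rightarrow> 'v \<Rightarrow> 'v \<Rightarrow> 'k) \<Rightarrow> 'i filter \<Rightarrow> 'v \<Rightarrow> 'v \<Rightarrow> ('i \<Rightarrow> 'k) set" where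
  "ultra_form ip U x y = ultra_class U (\<lambda>i. ip i x y)"

definition ultra_extension ::
  "('k::field \<Rightarrow> 'v::ab_group_add \<Rightarrow> 'v) \<Rightarrow> 'i filter \<Rightarrow>
   (('i \<Rightarrow> 'k) set, ('v \<times> ('i \<Rightarrow> 'k) set \<Rightarrow>\<^sub>0 int) set) module" where
  "ultra_extension scale U = scalar_extension scale (ultrapower U) (ultra_const U)"

definition ultra_extended_form ::
  "('i \<Rightarrow> 'v \<Rightarrow> 'v \<Rightarrow> 'k::field) \<Rightarrow> 'i filter \<Rightarrow>
   ('v \<times> ('i \<Rightarrow> 'k) set \<Rightarrow>\<^sub>0 int) set \<Rightarrow> ('v \<times> ('i \<Rightarrow> 'k) set \<Rightarrow>\<^sub>0 int) set \<Rightarrow> ('i \<Rightarrow> 'k) set" where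
  "ultra_extended_form ip U = extended_form (ultrapower U) (ultra_form ip U)"

lemma scalar_ext_ultra: "scalar_ext (ultrapower U) (ultra_const U)"
  by (simp add: scalar_ext_def scalar_ext_axioms_def cring_ultrapower ultra_const_def)

lemma module_ultra_extension: "Module.module (ultrapower U) (ultra_extension scale U)"
  unfolding ultra_extension_def by (rule scalar_ext.module_M[OF scalar_ext_ultra])

lemma scalar_ext_form_ultra:
  fixes ip :: "'i \<Rightarrow> 'v::ab_group_add \<Rightarrow> 'v \<Rightarrow> 'k::field"
  assumes "\<And>i. inner_product scale (ip i)"
  shows "scalar_ext_form (ultrapower U) scale (ultra_const U) (ultra_form ip U)"
proof -
  have lin: "Vector_Spaces.linear scale (*) (ip i x)" and sym: "ip i x y = ip i y x" for i x y
    using assms unfolding inner_product_def by blast+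
  note hom = Vector_Spaces.linear.axioms(3)[OF lin]
  have "ip i z (x + y) = ip i z x + ip i z y" "ip i z (scale c x) = c * ip i z x" for i x y z c
    using module_hom.add[OF hom] module_hom.scale[OF hom] by blast+
  then have "ip i (x + y) z = ip i x z + ip i y z" "ip i (scale c x) z = c * ip i x z" for i x y z c
    using sym by simp_all
  moreover have "ultra_form ip U x y = ultra_form ip U y x" for x y
    unfolding ultra_form_def by (subst sym) (rule refl)
  ultimately show ?thesis
    by (simp add: scalar_ext_form_def scalar_ext_ultra scalar_ext_form_axioms_def
        ultra_form_def ultra_const_def)
qed

lemma inner_product_ultra_extended_form:
  assumes "\<And>i. inner_product scale (ip i)"
  shows "module_inner_product (ultrapower U) (ultra_extension scale U) (ultra_extended_form ip U)"
  unfolding ultra_extension_def ultra_extended_form_def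
  by (rule scalar_ext_form.inner_product_extended_form[OF scalar_ext_form_ultra[OF assms]])

lemma ultra_extended_form_pure:
  assumes "\<And>i. inner_product scale (ip i)"
    and "a \<in> carrier (ultrapower U)" "b \<in> carrier (ultrapower U)"
  shows "ultra_extended_form ip U
           (pure_tensor scale (ultrapower U) (ultra_const U) x a)
           (pure_tensor scale (ultrapower U) (ultra_const U) y b) =
         a \<otimes>\<^bsub>ultrapower U\<^esub> b \<otimes>\<^bsub>ultrapower U\<^esub> ultra_form ip U x y"
  unfolding ultra_extended_form_def
  by (rule scalar_ext_form.extended_form_pure[OF scalar_ext_form_ultra[OF assms(1)] assms(2,3)])

end

theory Submission
  imports Defs
begin

text \<open>
  Radical elements of \<open>V \<otimes> F\<close> are compared with pathological elements of \<open>V\<close>, in both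
  directions through pure tensors \<open>x \<otimes> 1\<close>.

  Suppose \<open>B\<close> is a common orthogonal basis. It is also orthogonal for the ultrapower-valued form, so
  pairing \<open>X = \<Sum> v \<otimes> a\<^sub>v\<close> with \<open>w \<otimes> 1\<close> isolates \<open>a\<^sub>w \<langle>\<langle>w, w\<rangle>\<rangle>\<close>, and \<open>V \<otimes> F\<close> has zero radical as
  soon as no \<open>\<langle>\<langle>w, w\<rangle>\<rangle>\<close> vanishes
  (\<open>radical_orthogonal_basis\<close>). If \<open>\<langle>\<langle>w, w\<rangle>\<rangle> = 0\<close>, then \<open>\<langle>w, w\<rangle>\<^sub>i = 0\<close> for almost all \<open>i\<close>; for
  such an \<open>i\<close> the basis vector \<open>w\<close> is orthogonal to every element of \<open>B\<close>, hence to all of \<open>V\<close>.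
  So \<open>w\<close> would be a nonzero pathological element.

  Conversely, testing pathology on the lines of \<open>V\<close> shows that a pathological \<open>x\<close> satisfies
  \<open>\<langle>\<langle>x, y\<rangle>\<rangle> = 0\<close> for all \<open>y\<close>, so \<open>x \<otimes> 1\<close> lies in the radical. If the radical is zero, then
  \<open>x \<otimes> 1 = 0\<close>, and \<open>x = 0\<close> because \<open>V\<close> embeds into \<open>V \<otimes> F\<close> (\<open>pure_tensor_one_eq_zeroD\<close>).
\<close>

section \<open>Expansion along a spanning set\<close>

context scalar_ext
begin

lemma pure_tensor_zero_right: "pt x \<zero> = \<zero>\<^bsub>M\<^esub>"
proof -
  interpret MM: Module.module F M by (rule module_M)
  have "pt x \<zero> \<oplus>\<^bsub>M\<^esub> pt x \<zero> = pt x \<zero>"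
    using pure_tensor_add_right[of \<zero> \<zero> x] by simp
  then show ?thesis by (simp add: MM.add.l_cancel_one)
qed

lemma pure_tensor_zero_left:
  assumes "a \<in> carrier F"
  shows "pt 0 a = \<zero>\<^bsub>M\<^esub>"
proof -
  interpret MM: Module.module F M by (rule module_M)
  have "pt 0 a \<oplus>\<^bsub>M\<^esub> pt 0 a = pt 0 a"
    using pure_tensor_add_left[of a 0 0] assms by simp
  then show ?thesis using assms by (simp add: MM.add.l_cancel_one)
qed

lemma pure_tensor_linear_combination:
  assumes "finite T" "a \<in> carrier F"
  shows "pt (\<Sum>v\<in>T. scale (r v) v) a = (\<Oplus>\<^bsub>M\<^esub>v\<in>T. pt v (\<iota> (r v) \<otimes> a))"
proof -
  interpret MM: Module.module F M by (rule module_M)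
  show ?thesis
    using assms(1)
  proof (induction T)
    case empty
    then show ?case using assms(2) by (simp add: pure_tensor_zero_left)
  next
    case (insert w T)
    then show ?case
      using assms(2) by (simp add: pure_tensor_add_left pure_tensor_scale Pi_def)
  qed
qed

text \<open>
  The ground scalars form a bare type here, so that \<open>B\<close> spans is expressed through explicit linear
  combinations.
  The coefficients are total functions with values in \<open>F\<close>, so that two expansions can be subtracted
  coefficientwise once both are padded with zeros to the union of their supports.
\<close>

lemma spanning_set_expansion:
  assumes span: "\<And>x. \<exists>T r. finite T \<and> T \<subseteq> B \<and> x = (\<Sum>v\<in>T. scale (r v) v)"
    and X: "X \<in> carrier M"
  obtains T a where "finite T" "T \<subseteq> B" "\<And>v. a v \<in> carrier F" "X = (\<Oplus>\<^bsub>M\<^esub>v\<in>T. pt v (a v))"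
proof -
  interpret MM: Module.module F M by (rule module_M)
  define expands where "expands X \<longleftrightarrow>
    (\<exists>T a. finite T \<and> T \<subseteq> B \<and> (\<forall>v. a v \<in> carrier F) \<and> X = (\<Oplus>\<^bsub>M\<^esub>v\<in>T. pt v (a v)))" for X
  obtain s where s: "s \<in> carrier G" "X = N #>\<^bsub>G\<^esub> s" using X by (auto simp: carrier_M)
  from s(1) have "expands (N #>\<^bsub>G\<^esub> s)"
  proof (induction rule: G_induct)
    case zero
    have "N #>\<^bsub>G\<^esub> 0 = (\<Oplus>\<^bsub>M\<^esub>v\<in>{}. pt v \<zero>)" by (simp flip: zero_M)
    then show ?case unfolding expands_def by (intro exI[of _ "{}"] exI[of _ "\<lambda>_. \<zero>"]) auto
  next
    case (of x a)
    obtain T r where T: "finite T" "T \<subseteq> B" "x = (\<Sum>v\<in>T. scale (r v) v)"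
      using span by blast
    have "N #>\<^bsub>G\<^esub> frag_of (x, a) = (\<Oplus>\<^bsub>M\<^esub>v\<in>T. pt v (\<iota> (r v) \<otimes> a))"
      using pure_tensor_linear_combination[OF T(1) of, of r] T(3) by (simp add: pure_tensor_def)
    then show ?case
      using T(1,2) of unfolding expands_def
      by (intro exI[of _ T] exI[of _ "\<lambda>v. \<iota> (r v) \<otimes> a"]) auto
  next
    case (diff s t)
    obtain S a where S: "finite S" "S \<subseteq> B" "\<And>v. a v \<in> carrier F"
      "N #>\<^bsub>G\<^esub> s = (\<Oplus>\<^bsub>M\<^esub>v\<in>S. pt v (a v))"
      using diff(3) unfolding expands_def by blast
    obtain T b where T: "finite T" "T \<subseteq> B" "\<And>v. b v \<in> carrier F"
      "N #>\<^bsub>G\<^esub> t = (\<Oplus>\<^bsub>M\<^esub>v\<in>T. pt v (b v))"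
      using diff(4) unfolding expands_def by blast
    define a' where "a' v = (if v \<in> S then a v else \<zero>)" for v
    define b' where "b' v = (if v \<in> T then b v else \<zero>)" for v
    have a': "a' v \<in> carrier F" and b': "b' v \<in> carrier F" for v
      using S(3) T(3) by (auto simp: a'_def b'_def)
    have sa: "N #>\<^bsub>G\<^esub> s = (\<Oplus>\<^bsub>M\<^esub>v\<in>S \<union> T. pt v (a' v))" unfolding S(4)
      by (rule MM.add.finprod_mono_neutral_cong_left)
        (use S T in \<open>auto simp: a'_def pure_tensor_zero_right\<close>)
    have tb: "N #>\<^bsub>G\<^esub> t = (\<Oplus>\<^bsub>M\<^esub>v\<in>S \<union> T. pt v (b' v))" unfolding T(4)
      by (rule MM.add.finprod_mono_neutral_cong_left)
        (use S T in \<open>auto simp: b'_def pure_tensor_zero_right\<close>)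
    let ?D = "\<Oplus>\<^bsub>M\<^esub>v\<in>S \<union> T. pt v (a' v \<ominus> b' v)"
    have cancel: "(a' v \<ominus> b' v) \<oplus> b' v = a' v" for v
      using a'[of v] b'[of v] by (simp add: minus_eq a_assoc l_neg)
    have sum: "?D \<oplus>\<^bsub>M\<^esub> (N #>\<^bsub>G\<^esub> t) = N #>\<^bsub>G\<^esub> s"
      unfolding sa tb using a' b'
      by (subst MM.finsum_addf[symmetric]) (auto simp: cancel simp flip: pure_tensor_add_right)
    have "?D \<in> carrier M" using a' b' by (intro MM.finsum_closed) auto
    then obtain r where r: "r \<in> carrier G" "?D = N #>\<^bsub>G\<^esub> r" by (auto simp: carrier_M)
    have "r + t \<in> carrier G" using G.m_closed[OF r(1) diff(2)] by simp
    then have "r + t - s \<in> N"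
      using sum diff(1,2) r by (simp add: add_M coset_eq_iff)
    then have "r - (s - t) \<in> N" by (simp add: algebra_simps)
    then have "N #>\<^bsub>G\<^esub> (s - t) = ?D"
      using coset_eq_iff[of r "s - t"] r diff(1,2) by simp
    then show ?case
      unfolding expands_def using S T a' b'
      by (intro exI[of _ "S \<union> T"] exI[of _ "\<lambda>v. a' v \<ominus> b' v"]) auto
  qed
  then show ?thesis using that s(2) unfolding expands_def by blast
qed

end


section \<open>The radical of the extended form\<close>

context scalar_ext_form
begin

lemma extended_form_finsum_left:
  assumes "finite T" "\<And>v. v \<in> T \<Longrightarrow> X v \<in> carrier M" "Y \<in> carrier M"
  shows "extended_form F \<beta> (\<Oplus>\<^bsub>M\<^esub>v\<in>T. X v) Y = (\<Oplus>v\<in>T. extended_form F \<beta> (X v) Y)"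
proof -
  interpret MM: Module.module F M by (rule module_M)
  let ?B = "extended_form F \<beta>"
  have closed: "?B P Q \<in> carrier F" and sym: "?B P Q = ?B Q P"
    if "P \<in> carrier M" "Q \<in> carrier M" for P Q
    using inner_product_extended_form that unfolding module_inner_product_def by blast+
  have add: "?B (P \<oplus>\<^bsub>M\<^esub> P') Q = ?B P Q \<oplus> ?B P' Q"
    if "P \<in> carrier M" "P' \<in> carrier M" "Q \<in> carrier M" for P P' Q
    using inner_product_extended_form that sym MM.a_closed
    unfolding module_inner_product_def by metis
  show ?thesis using assms(1,2)
  proof (induction T)
    case empty
    have "?B \<zero>\<^bsub>M\<^esub> Y \<oplus> ?B \<zero>\<^bsub>M\<^esub> Y = ?B \<zero>\<^bsub>M\<^esub> Y" using add[of "\<zero>\<^bsub>M\<^esub>" "\<zero>\<^bsub>M\<^esub>" Y] assms(3) by simp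
    then show ?case using closed[of "\<zero>\<^bsub>M\<^esub>" Y] assms(3) by (simp add: add.l_cancel_one)
  next
    case (insert w T)
    then have "(\<Oplus>\<^bsub>M\<^esub>v\<in>T. X v) \<in> carrier M" by (intro MM.finsum_closed) auto
    then show ?case using insert assms(3) closed by (simp add: add Pi_def)
  qed
qed

text \<open>
  Pairing with \<open>w \<otimes> 1\<close> reads off the coefficient at \<open>w\<close> up to the factor \<open>\<beta> w w\<close>, which can be
  cancelled in a domain.
\<close>

lemma radical_orthogonal_basis:
  assumes span: "\<And>x. \<exists>T r. finite T \<and> T \<subseteq> B \<and> x = (\<Sum>v\<in>T. scale (r v) v)"
    and "domain F"
    and orth: "\<And>v w. v \<in> B \<Longrightarrow> w \<in> B \<Longrightarrow> v \<noteq> w \<Longrightarrow> \<beta> v w = \<zero>"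
    and aniso: "\<And>v. v \<in> B \<Longrightarrow> \<beta> v v \<noteq> \<zero>"
  shows "radical F M (extended_form F \<beta>) = {\<zero>\<^bsub>M\<^esub>}"
proof (intro equalityI subsetI)
  interpret MM: Module.module F M by (rule module_M)
  interpret domain F by fact
  fix X assume "X \<in> radical F M (extended_form F \<beta>)"
  then have X: "X \<in> carrier M" and rad: "\<And>Y. Y \<in> carrier M \<Longrightarrow> extended_form F \<beta> X Y = \<zero>"
    by (auto simp: radical_def)
  obtain T a where T: "finite T" "T \<subseteq> B" "\<And>v. a v \<in> carrier F"
    "X = (\<Oplus>\<^bsub>M\<^esub>v\<in>T. pt v (a v))"
    using spanning_set_expansion[OF span X] by blast
  have "a w = \<zero>" if w: "w \<in> T" for w
  proof -
    have "\<zero> = (\<Oplus>v\<in>T. extended_form F \<beta> (pt v (a v)) (pt w \<one>))"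
      using rad[of "pt w \<one>"] T by (simp add: extended_form_finsum_left)
    also have "\<dots> = (\<Oplus>v\<in>T. if w = v then a v \<otimes> \<beta> v v else \<zero>)"
      using T w orth by (intro finsum_cong') (auto simp: extended_form_pure subset_iff)
    also have "\<dots> = a w \<otimes> \<beta> w w"
      using T w by (intro add.finprod_singleton) auto
    finally show ?thesis using aniso[of w] T w integral[of "a w" "\<beta> w w"] by auto
  qed
  then have "X = (\<Oplus>\<^bsub>M\<^esub>v\<in>T. \<zero>\<^bsub>M\<^esub>)"
    unfolding T(4) by (intro MM.finsum_cong') (auto simp: pure_tensor_zero_right)
  then show "X \<in> {\<zero>\<^bsub>M\<^esub>}" by simp
next
  interpret MM: Module.module F M by (rule module_M)
  fix X assume X: "X \<in> {\<zero>\<^bsub>M\<^esub>}"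
  have "extended_form F \<beta> \<zero>\<^bsub>M\<^esub> Y = \<zero>" if "Y \<in> carrier M" for Y
    using extended_form_finsum_left[of "{}" "\<lambda>_. \<zero>\<^bsub>M\<^esub>" Y] that by simp
  with X show "X \<in> radical F M (extended_form F \<beta>)" by (simp add: radical_def)
qed

lemma pure_tensor_in_radical:
  assumes "\<And>y. \<beta> x y = \<zero>" "a \<in> carrier F"
  shows "pt x a \<in> radical F M (extended_form F \<beta>)"
proof -
  have "free_form F \<beta> (frag_of (x, a)) t = \<zero>" if "t \<in> carrier G" for t
    using that
  proof (induction rule: G_induct)
    case zero
    then show ?case using assms(2) by (simp add: hom_A(4)[OF free_form_hom_right])
  next
    case (of y b)
    then show ?case using assms by (simp add: free_form_of)
  next
    case (diff t t')
    then show ?case using assms(2) by (simp add: hom_A(3)[OF free_form_hom_right] minus_eq)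
  qed
  then show ?thesis
    using assms(2) by (auto simp: radical_def carrier_M pure_tensor_def extended_form_coset)
qed

end


section \<open>The embedding of the vector space into its extension\<close>

text \<open>
  A nonzero \<open>x\<close> takes the value \<open>1\<close> under some linear functional \<open>f\<close>. The map
  \<open>y \<otimes> a \<mapsto> f(y) a\<close> is then well defined on \<open>V \<otimes> F\<close> and sends \<open>x \<otimes> 1\<close> to \<open>1\<close>.
\<close>

lemma pure_tensor_one_eq_zeroD:
  fixes scale :: "'k::field \<Rightarrow> 'v::ab_group_add \<Rightarrow> 'v" and F :: "('f, 'm) ring_scheme" (structure)
  assumes "vector_space scale" "scalar_ext F \<iota>" "\<zero> \<noteq> \<one>"
    and \<iota>_add: "\<And>c d. \<iota> (c + d) = \<iota> c \<oplus> \<iota> d"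
    and \<iota>_mult: "\<And>c d. \<iota> (c * d) = \<iota> c \<otimes> \<iota> d"
    and \<iota>_one: "\<iota> 1 = \<one>"
    and zero: "pure_tensor scale F \<iota> x \<one> = \<zero>\<^bsub>scalar_extension scale F \<iota>\<^esub>"
  shows "x = 0"
proof (rule ccontr)
  assume "x \<noteq> 0"
  interpret vector_space scale by fact
  interpret E: scalar_ext F scale \<iota> by fact
  define B where "B = extend_basis {x}"
  have "independent {x}" using \<open>x \<noteq> 0\<close> by simp
  then have B: "independent B" "x \<in> B" "span B = UNIV"
    using extend_basis_superset[of "{x}"] independent_extend_basis[of "{x}"]
      span_extend_basis[of "{x}"] by (auto simp: B_def)
  \<comment> \<open>The coordinate at \<open>x\<close> in a basis through \<open>x\<close> is the required functional.\<close>
  define f where "f y = representation B y x" for y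
  have f_add: "f (y + z) = f y + f z" and f_scale: "f (scale c y) = c * f y" for y z c
    using B by (simp_all add: f_def representation_add representation_scale)
  have f_x: "f x = 1" using B by (simp add: f_def representation_basis)
  define h where "h = frag_eval (add_monoid F) (\<lambda>(y, a). \<iota> (f y) \<otimes> a)"
  have A: "comm_group (add_monoid F)" by (rule E.a_comm_group)
  have h_hom: "h \<in> hom E.G (add_monoid F)"
    unfolding h_def tensor_free_def by (rule frag_eval_hom[OF A]) auto
  interpret h: group_hom E.G "add_monoid F" h
    using h_hom A by (simp add: group_hom_def group_hom_axioms_def E.G.is_group comm_group_def)
  have h_of: "h (frag_of (y, a)) = \<iota> (f y) \<otimes> a" if "a \<in> carrier F" for y a
    using that unfolding h_def by (subst frag_eval_frag_of[OF A]) auto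
  have h_diff: "h (s - t) = h s \<ominus> h t" if "s \<in> carrier E.G" "t \<in> carrier E.G" for s t
    using h.hom_mult[OF that(1) E.G.inv_closed[OF that(2)]] h.hom_inv[OF that(2)] that
    by (simp add: E.G_inv a_minus_def a_inv_def)
  have cancel: "u \<ominus> v \<ominus> w = \<zero>" if "u = v \<oplus> w" "v \<in> carrier F" "w \<in> carrier F" for u v w
    using that E.r_neg[of "v \<oplus> w"] by (simp add: E.minus_eq E.minus_add E.a_assoc)
  have "h r = \<zero>" if "r \<in> tensor_relators scale F \<iota>" for r
    using that unfolding tensor_relators_def
  proof (elim UnE CollectE exE conjE, goal_cases)
    case (1 y z a)
    show ?case unfolding 1(1) using 1(2)
      by (simp add: h_diff h_of cancel f_add \<iota>_add E.l_distr)
  next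
    case (2 y a b)
    show ?case unfolding 2(1) using 2(2,3)
      by (simp add: h_diff h_of cancel E.r_distr)
  next
    case (3 c y a)
    show ?case unfolding 3(1) using 3(2)
      by (simp add: h_diff h_of f_scale \<iota>_mult E.minus_eq E.m_ac E.r_neg)
  qed
  then have h_N: "h n = \<zero>" if "n \<in> E.N" for n
    using E.hom_kills_N[OF h_hom _ _ that] A by (simp add: comm_group_def)
  have "frag_of (x, \<one>) - 0 \<in> E.N"
    using zero E.G.one_closed by (simp add: pure_tensor_def E.zero_M E.coset_eq_iff)
  then have "h (frag_of (x, \<one>)) = \<zero>" using h_N by simp
  then show False using h_of[of \<one> x] f_x \<iota>_one \<open>\<zero> \<noteq> \<one>\<close> by simp
qed


section \<open>Pathological elements\<close>

lemma inner_product_simps: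
  assumes "inner_product scale b"
  shows "b x (y + z) = b x y + b x z" "b x (scale c y) = c * b x y" "b x 0 = 0" "b x y = b y x"
proof -
  have lin: "Vector_Spaces.linear scale (*) (b x)" and "b x y = b y x"
    using assms unfolding inner_product_def by blast+
  then show "b x y = b y x" by blast
  note hom = Vector_Spaces.linear.axioms(3)[OF lin]
  show "b x (y + z) = b x y + b x z" "b x (scale c y) = c * b x y" "b x 0 = 0"
    using module_hom.add[OF hom] module_hom.scale[OF hom] module_hom.zero[OF hom] by blast+
qed

lemma inner_product_vanishes_on_span:
  assumes "Modules.module scale" "inner_product scale b"
    and "y \<in> Modules.module.span scale B" "\<And>w. w \<in> B \<Longrightarrow> b x w = 0"
  shows "b x y = 0"
  by (rule Modules.module.span_induct_alt[OF assms(1,3), where h = "\<lambda>y. b x y = 0"])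
    (simp_all add: inner_product_simps(1-3)[OF assms(2)] assms(4))

text \<open>
  A finite-dimensional subspace is tested by a finite spanning set, and a filter is closed under
  finite intersections; so it suffices to test lines, one vector \<open>y\<close> at a time.
\<close>

lemma path_elements_iff_ultra_form_zero:
  fixes scale :: "'k::field \<Rightarrow> 'v::ab_group_add \<Rightarrow> 'v"
  assumes "vector_space scale" "\<And>i. inner_product scale (ip i)"
  shows "x \<in> path_elements scale ip U \<longleftrightarrow> (\<forall>y. ultra_form ip U x y = \<zero>\<^bsub>ultrapower U\<^esub>)"
proof -
  interpret vector_space scale by fact
  have mod: "Modules.module scale" by (rule module_axioms)
  have zero_iff: "ultra_form ip U x y = \<zero>\<^bsub>ultrapower U\<^esub> \<longleftrightarrow> eventually (\<lambda>i. ip i x y = 0) U" for y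
    by (simp add: ultra_form_def ultrapower_zero ultra_class_eq_iff)
  show ?thesis unfolding zero_iff
  proof (intro iffI allI)
    fix y assume "x \<in> path_elements scale ip U"
    moreover have "finite_dimensional_subspace scale (span {y})"
      unfolding finite_dimensional_subspace_def
      by (intro conjI subspace_span exI[of _ "{y}"]) auto
    ultimately have "eventually (\<lambda>i. \<forall>z\<in>span {y}. ip i x z = 0) U"
      by (simp add: path_elements_def)
    then show "eventually (\<lambda>i. ip i x y = 0) U"
      by (rule eventually_mono) (auto intro: span_base)
  next
    assume zero: "\<forall>y. eventually (\<lambda>i. ip i x y = 0) U"
    have "eventually (\<lambda>i. \<forall>y\<in>span C. ip i x y = 0) U" if "finite C" for C
    proof -
      have "eventually (\<lambda>i. \<forall>w\<in>C. ip i x w = 0) U"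
        using zero that by (simp add: eventually_ball_finite)
      then show ?thesis
        by (rule eventually_mono) (blast intro: inner_product_vanishes_on_span[OF mod assms(2)])
    qed
    then show "x \<in> path_elements scale ip U"
      by (auto simp: path_elements_def finite_dimensional_subspace_def)
  qed
qed


theorem theorem3:
  fixes scale :: "'k::field \<Rightarrow> 'v::ab_group_add \<Rightarrow> 'v"
    and ip :: "'i \<Rightarrow> 'v \<Rightarrow> 'v \<Rightarrow> 'k"
    and le :: "'i \<Rightarrow> 'i \<Rightarrow> bool"
    and U :: "'i filter"
  assumes "vector_space scale"
    and "\<And>i. inner_product scale (ip i)"
    and "reflp le" and "transp le"
    and "\<And>i j. \<exists>k. le i k \<and> le j k"
    and "ultrafilter U"
    and "\<And>i. eventually (\<lambda>j. j \<in> {j. le i j}) U"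
  shows "(nonpathological scale ip U \<and> simultaneously_orthogonalizable scale ip \<longrightarrow>
            nondegenerate (ultrapower U) (ultra_extension scale U) (ultra_extended_form ip U)) \<and>
         (nondegenerate (ultrapower U) (ultra_extension scale U) (ultra_extended_form ip U) \<longrightarrow>
            nonpathological scale ip U)"
proof (intro conjI impI)
  interpret vector_space scale by fact
  interpret E: scalar_ext_form "ultrapower U" scale "ultra_const U" "ultra_form ip U"
    by (rule scalar_ext_form_ultra[OF assms(2)])
  interpret F: Ring.field "ultrapower U" by (rule field_ultrapower[OF assms(6)])
  have mod: "Modules.module scale" by (rule module_axioms)
  note path_iff = path_elements_iff_ultra_form_zero[OF assms(1,2)]
  {
    assume hyp: "nonpathological scale ip U \<and> simultaneously_orthogonalizable scale ip"
    then obtain B where B: "independent B" "span B = UNIV"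
      and orth: "\<And>i v w. v \<in> B \<Longrightarrow> w \<in> B \<Longrightarrow> v \<noteq> w \<Longrightarrow> ip i v w = 0"
      unfolding simultaneously_orthogonalizable_def by blast
    have "ultra_form ip U v v \<noteq> \<zero>\<^bsub>ultrapower U\<^esub>" if v: "v \<in> B" for v
    proof
      assume "ultra_form ip U v v = \<zero>\<^bsub>ultrapower U\<^esub>"
      then have null: "eventually (\<lambda>i. ip i v v = 0) U"
        by (simp add: ultra_form_def ultrapower_zero ultra_class_eq_iff)
      \<comment> \<open>The other basis vectors are orthogonal to \<open>v\<close> anyway, so isotropy puts \<open>v\<close> in the radical.\<close>
      have "ip i v y = 0" if "ip i v v = 0" for i y
        by (rule inner_product_vanishes_on_span[OF mod assms(2), where B = B])
          (use B(2) orth[OF v] that in auto)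
      then have "eventually (\<lambda>i. ip i v y = 0) U" for y
        using null by (auto elim: eventually_mono)
      then have "v \<in> path_elements scale ip U"
        by (simp add: path_iff ultra_form_def ultrapower_zero ultra_class_eq_iff)
      then have "v = 0" using hyp by (simp add: nonpathological_def)
      then show False using B(1) v dependent_zero by blast
    qed
    moreover have "ultra_form ip U v w = \<zero>\<^bsub>ultrapower U\<^esub>" if "v \<in> B" "w \<in> B" "v \<noteq> w" for v w
      using orth that by (simp add: ultra_form_def ultrapower_zero)
    moreover have "\<exists>T r. finite T \<and> T \<subseteq> B \<and> x = (\<Sum>v\<in>T. scale (r v) v)" for x
      using B(2) unfolding span_explicit by blast
    ultimately show
      "nondegenerate (ultrapower U) (ultra_extension scale U) (ultra_extended_form ip U)"
      unfolding nondegenerate_def ultra_extension_def ultra_extended_form_def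
      using E.radical_orthogonal_basis[of B, OF _ F.domain_axioms] by blast
  next
    assume nondeg: "nondegenerate (ultrapower U) (ultra_extension scale U) (ultra_extended_form ip U)"
    have "x = 0" if "x \<in> path_elements scale ip U" for x
    proof (rule pure_tensor_one_eq_zeroD[OF assms(1) E.scalar_ext_axioms])
      have "E.pt x \<one>\<^bsub>ultrapower U\<^esub> \<in>
          radical (ultrapower U) E.M (extended_form (ultrapower U) (ultra_form ip U))"
        using that by (intro E.pure_tensor_in_radical) (simp_all add: path_iff)
      then show "E.pt x \<one>\<^bsub>ultrapower U\<^esub> = \<zero>\<^bsub>E.M\<^esub>"
        using nondeg by (simp add: nondegenerate_def ultra_extension_def ultra_extended_form_def)
    qed (use F.zero_not_one in \<open>simp_all add: ultra_const_def flip: ultrapower_one\<close>)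
    moreover have "0 \<in> path_elements scale ip U"
    proof -
      have "ip i 0 y = 0" for i y
        using inner_product_simps(3,4)[OF assms(2)] by metis
      then show ?thesis by (simp add: path_elements_def)
    qed
    ultimately show "nonpathological scale ip U" by (auto simp: nonpathological_def)
  }
qed

end
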